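(* For every integer $n\geq 2$, the set $\mathcal{R}(n)\subseteq\mathbb{C}$ of roots in the closed upper half-plane of $n$-dimensional relative Steiner polynomials is closed (as a subset of $\mathbb{C}$).
   Context: $\mathcal{K}^n$ denotes the set of all convex bodies (non-empty compact convex sets, possibly with empty interior) in $\mathbb{R}^n$; $\dim$ of a convex body is the dimension of its affine hull. For $K,E\in\mathcal{K}^n$ and $\lambda\geq 0$, the volume ($n$-dimensional Lebesgue measure) of the Minkowski sum $K+\lambda E$ is a polynomial in $\lambda$, written $\mathrm{vol}(K+\lambda E)=\sum_{i=0}^n\binom{n}{i}\mathrm{W}_i(K;E)\lambda^i$; the numbers $\mathrm{W}_i(K;E)$ are the relative quermassintegrals. The relative Steiner polynomial of $(K,E)$ is the polynomial $f_{K;E}(z)=\sum_{i=0}^n\binom{n}{i}\mathrm{W}_i(K;E)z^i$ in the complex variable $z$. Let $\mathbb{C}^+=\{z\in\mathbb{C}:\operatorname{Im}(z)\geq 0\}$. For $n\geq 2$, $\mathcal{R}(n)=\{z\in\mathbb{C}^+: f_{K;E}(z)=0\text{ for some }K,E\in\mathcal{K}^n\text{ with }\dim(K+E)=n\}$. *)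

theory Defs
  imports "HOL-Analysis.Analysis" "HOL-Computational_Algebra.Polynomial"
begin

definition convex_body :: "(real ^ 'n) set \<Rightarrow> bool" where
  "convex_body K \<longleftrightarrow> convex K \<and> compact K \<and> K \<noteq> {}"

text \<open>
  \<open>relative_quermassintegrals K E W\<close> says that \<open>W i\<close> is \<open>W\<^sub>i(K;E)\<close> for all \<open>i \<le> n\<close>, where
  \<open>n = CARD('n)\<close>. The values \<open>W i\<close> with \<open>i > n\<close> play no role. For convex bodies such a \<open>W\<close>
  exists by the theorem of Minkowski and Steiner; uniqueness is shown below. The sum of sets is
  the Minkowski sum from \<^theory>\<open>HOL-Library.Set_Algebras\<close>.
\<close>

definition relative_quermassintegrals ::
  "(real ^ 'n) set \<Rightarrow> (real ^ 'n) set \<Rightarrow> (nat \<Rightarrow> real) \<Rightarrow> bool" where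
  "relative_quermassintegrals K E W \<longleftrightarrow>
     (\<forall>l::real. l \<ge> 0 \<longrightarrow>
        measure lebesgue (K + (\<lambda>x. l *\<^sub>R x) ` E) =
          (\<Sum>i\<le>CARD('n). real (CARD('n) choose i) * W i * l ^ i))"

definition relative_steiner_polynomial ::
  "(real ^ 'n) set \<Rightarrow> (real ^ 'n) set \<Rightarrow> complex poly \<Rightarrow> bool" where
  "relative_steiner_polynomial K E f \<longleftrightarrow>
     (\<exists>W. relative_quermassintegrals K E W \<and>
          f = (\<Sum>i\<le>CARD('n). monom (of_real (real (CARD('n) choose i) * W i)) i))"

definition steiner_roots :: "'n::finite itself \<Rightarrow> complex set" where
  "steiner_roots _ =
     {z. Im z \<ge> 0 \<and>
         (\<exists>(K :: (real ^ 'n) set) E f.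
            convex_body K \<and> convex_body E \<and> aff_dim (K + E) = int CARD('n) \<and>
            relative_steiner_polynomial K E f \<and> poly f z = 0)}"

lemma relative_quermassintegrals_unique:
  fixes K E :: "(real ^ 'n) set"
  assumes V: "relative_quermassintegrals K E V" and W: "relative_quermassintegrals K E W"
    and i: "i \<le> CARD('n)"
  shows "V i = W i"
proof -
  let ?p = "\<lambda>U. \<Sum>i\<le>CARD('n). monom (real (CARD('n) choose i) * U i) i"
  have "poly (?p V - ?p W) l = 0" if "l \<ge> 0" for l
    using V W that by (simp add: relative_quermassintegrals_def poly_sum poly_monom)
  hence "{0..1} \<subseteq> {l. poly (?p V - ?p W) l = 0}"
    by auto
  moreover have "infinite {0..1::real}"
    by (simp add: infinite_Icc)
  ultimately have "?p V - ?p W = 0"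
    using poly_roots_finite finite_subset by blast
  hence "coeff (?p V) i = coeff (?p W) i"
    by simp
  moreover have "coeff (?p U) i = real (CARD('n) choose i) * U i" for U
    using i by (simp add: coeff_sum sum.delta)
  moreover have "real (CARD('n) choose i) \<noteq> 0"
    using i by simp
  ultimately show ?thesis
    by simp
qed

lemma relative_steiner_polynomial_unique:
  assumes "relative_steiner_polynomial K E f" "relative_steiner_polynomial K E g"
  shows "f = g"
  using assms relative_quermassintegrals_unique
  unfolding relative_steiner_polynomial_def
  by (smt (verit, best) atMost_iff sum.cong)

end

theory Submission
  imports Defs "HOL-Complex_Analysis.Great_Picard"
begin

text \<open>
  The roots of the Steiner polynomial of \<open>(K, E)\<close> do not change if \<open>K\<close> and \<open>E\<close> are translated
  independently and mapped by a common invertible linear map. Given roots \<open>\<zeta> k \<longlonglongrightarrow> z\<close>, one can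
  therefore normalize the bodies so that they lie in a fixed cube while \<open>K k + E k\<close> contains the
  origin and the standard basis. Blaschke's selection theorem yields limits \<open>K'\<close> and \<open>E'\<close> along a
  subsequence, and \<open>K' + E'\<close> still contains these \<open>n + 1\<close> points, so it is \<open>n\<close>-dimensional. By
  continuity of the volume, the Steiner polynomials converge pointwise on \<open>{0..}\<close>; hence their
  coefficients converge, the limit is the Steiner polynomial of \<open>(K', E')\<close> (so the theorem of
  Minkowski and Steiner is not needed), and \<open>z\<close> is a root of it.
\<close>

section \<open>Normalization by an invertible linear map\<close>

text \<open>
  Choose \<open>n\<close> points of \<open>D\<close> whose determinant is maximal in absolute value and take coordinates with
  respect to them: by Cramer's rule every point of \<open>D\<close> has coordinates of absolute value at most 1.
\<close>

lemma exists_normalizing_linear_map: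
  fixes D :: "(real ^ 'n::finite) set"
  assumes D: "compact D" "0 \<in> D" and dimD: "aff_dim D = int CARD('n)"
  obtains f :: "real ^ 'n \<Rightarrow> real ^ 'n" where "linear f" "inj f"
    "f ` D \<subseteq> cbox (- 1) 1" "\<And>i. axis i 1 \<in> f ` D"
proof -
  \<comment> \<open>The candidate \<open>n\<close>-tuples of points of \<open>D\<close>, stored as
    the rows of a matrix; this set is compact, so the determinant attains its maximal absolute value
    on it.\<close>
  define S where "S = {M :: real ^ 'n ^ 'n. \<forall>i. M $ i \<in> D}"
  obtain b where b: "\<And>x. x \<in> D \<Longrightarrow> norm x \<le> b"
    using D(1) compact_imp_bounded bounded_iff by metis
  have "closed S"
    unfolding S_def using D(1) by (intro closed_vector_box) (auto simp: compact_imp_closed)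
  moreover have "bounded S"
    unfolding bounded_iff
  proof (intro exI ballI)
    fix M assume "M \<in> S"
    have "norm M \<le> (\<Sum>i\<in>UNIV. norm (M $ i))"
      unfolding norm_vec_def by (rule L2_set_le_sum) auto
    also have "\<dots> \<le> (\<Sum>i\<in>(UNIV::'n set). b)"
      using \<open>M \<in> S\<close> b by (intro sum_mono) (auto simp: S_def)
    finally show "norm M \<le> (\<Sum>i\<in>(UNIV::'n set). b)" .
  qed
  ultimately have "compact S"
    by (simp add: compact_eq_bounded_closed)
  moreover have "S \<noteq> {}"
    using D(2) by (auto simp: S_def intro!: exI[of _ "\<chi> i. 0"])
  moreover have "continuous_on S (\<lambda>M. \<bar>det M\<bar>)"
    unfolding det_def by (intro continuous_intros)
  ultimately obtain M where M: "M \<in> S" and max: "\<And>N. N \<in> S \<Longrightarrow> \<bar>det N\<bar> \<le> \<bar>det M\<bar>"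
    using continuous_attains_sup by metis
  \<comment> \<open>Since \<open>0 \<in> D\<close>, full affine dimension means full linear
    dimension, so \<open>D\<close> contains a basis, and the matrix with these rows competes with
    \<open>M\<close>.\<close>
  have detM: "det M \<noteq> 0"
  proof -
    have "dim D = CARD('n)"
      using dimD D(2) aff_dim_zero[of D] by (simp add: hull_inc)
    then obtain B where B: "B \<subseteq> D" "independent B" "D \<subseteq> span B" "card B = CARD('n)"
      using basis_exists[of D] by metis
    have "finite B"
      using B(2) by (simp add: independent_imp_finite)
    then obtain h where h: "bij_betw h (UNIV::'n set) B"
      using B(4) finite_same_card_bij[of "UNIV :: 'n set" B] by auto
    define N :: "real ^ 'n ^ 'n" where "N = (\<chi> i. h i)"
    have "rows N = B"
      using h by (auto simp: rows_def row_def N_def bij_betw_def)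
    moreover have "span B = UNIV"
      using B \<open>dim D = CARD('n)\<close> by (metis DIM_cart DIM_real dim_eq_full dim_eq_card_independent mult.right_neutral)
    ultimately have "det N \<noteq> 0"
      by (metis matrix_left_invertible_span_rows invertible_det_nz invertible_left_inverse span_vec_eq)
    moreover have "N \<in> S"
      using h B(1) by (auto simp: S_def N_def bij_betw_def)
    ultimately show ?thesis
      using max[of N] by auto
  qed
  \<comment> \<open>The chosen points are the columns of \<open>A\<close>, so its inverse
    \<open>f\<close> takes coordinates with respect to them.\<close>
  define A where "A = transpose M"
  have detA: "det A \<noteq> 0"
    using detM by (simp add: A_def det_transpose)
  then obtain C where C: "A ** C = mat 1" "C ** A = mat 1"
    by (auto simp: invertible_def simp flip: invertible_det_nz)
  define f where "f = (*v) C"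
  have fA: "f (A *v y) = y" and Af: "A *v f y = y" for y
    using C by (simp_all add: f_def matrix_vector_mul_assoc)
  have "inj f"
    using Af by (metis injI)
  moreover have "f ` D \<subseteq> cbox (- 1) 1"
  proof -
    have "\<bar>f x $ k\<bar> \<le> 1" if "x \<in> D" for x k
    proof -
      have x: "(\<Sum>i\<in>UNIV. f x $ i *s row i M) = x"
        using Af[of x] by (simp add: matrix_mult_sum A_def column_transpose)
      have "det (\<chi> i. if i = k then x else row i M) = f x $ k * det M"
        using cramer_lemma_transpose[of k "f x" M] unfolding x .
      \<comment> \<open>Replacing one row by a point of \<open>D\<close> stays in \<open>S\<close>,
        so maximality bounds the new determinant.\<close>
      moreover have "(\<chi> i. if i = k then x else row i M) \<in> S"
        using M that by (simp add: S_def row_def)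
      ultimately have "\<bar>f x $ k\<bar> * \<bar>det M\<bar> \<le> 1 * \<bar>det M\<bar>"
        using max by (metis abs_mult mult_1)
      then show ?thesis
        using detM by (simp only: mult_le_cancel_right)
    qed
    then show ?thesis
      by (auto simp: mem_box_cart abs_le_iff minus_le_iff)
  qed
  moreover have "axis i 1 \<in> f ` D" for i
  proof -
    have "A *v axis i 1 = M $ i"
      by (simp add: A_def column_transpose row_def matrix_vector_mult_basis)
    then show ?thesis
      using fA[of "axis i 1"] M by (auto simp: S_def intro!: image_eqI[of _ _ "M $ i"])
  qed
  ultimately show ?thesis
    using that[of f] by (simp add: f_def)
qed

section \<open>Convergence of coefficients\<close>

text \<open>Induction on the degree bound: once the top coefficient is eliminated, the induction
  hypothesis gives convergence of all lower coefficients up to non-zero factors. Subtracting these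
  from the value at 1 leaves the top one.\<close>

lemma convergent_coefficients:
  fixes c :: "nat \<Rightarrow> nat \<Rightarrow> real"
  assumes "\<And>l. l > 0 \<Longrightarrow> convergent (\<lambda>k. \<Sum>i\<le>n. c k i * l ^ i)" and "j \<le> n"
  shows "convergent (\<lambda>k. c k j)"
  using assms
proof (induction n arbitrary: c j)
  case 0
  then show ?case using "0"(1)[of 1] by simp
next
  case (Suc n)
  let ?d = "\<lambda>k i. c k i * (2 ^ i - 2 ^ Suc n)"
  \<comment> \<open>the combination \<open>p (2 l) - 2 ^ Suc n * p l\<close> eliminates the leading coefficient\<close>
  have low: "convergent (\<lambda>k. c k i)" if "i \<le> n" for i
  proof -
    have "convergent (\<lambda>k. \<Sum>i\<le>n. ?d k i * l ^ i)" if "l > 0" for l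
    proof -
      have "convergent (\<lambda>k. (\<Sum>i\<le>Suc n. c k i * (2 * l) ^ i) - 2 ^ Suc n * (\<Sum>i\<le>Suc n. c k i * l ^ i))"
        using that by (intro convergent_diff convergent_mult convergent_const Suc.prems(1)) auto
      also have "(\<lambda>k. (\<Sum>i\<le>Suc n. c k i * (2 * l) ^ i) - 2 ^ Suc n * (\<Sum>i\<le>Suc n. c k i * l ^ i))
        = (\<lambda>k. \<Sum>i\<le>n. ?d k i * l ^ i)"
        by (auto simp: sum_distrib_left power_mult_distrib algebra_simps simp flip: sum_subtractf)
      finally show ?thesis .
    qed
    then have "convergent (\<lambda>k. ?d k i)"
      using Suc.IH[of ?d i] \<open>i \<le> n\<close> by blast
    moreover have "(2::real) ^ i - 2 ^ Suc n \<noteq> 0"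
      using that power_inject_exp[of "2::real" i "Suc n"] by linarith
    ultimately show ?thesis
      using convergent_mult_const_right_iff by blast
  qed
  have "convergent (\<lambda>k. (\<Sum>i\<le>Suc n. c k i * 1 ^ i) - (\<Sum>i\<le>n. c k i))"
    using low by (intro convergent_diff convergent_sum Suc.prems(1)) auto
  then have "convergent (\<lambda>k. c k (Suc n))"
    by simp
  with low Suc.prems(2) show ?case
    by (cases "j = Suc n") auto
qed

section \<open>Volume of linear images\<close>

text \<open>
  The library's \<open>measure_linear_image\<close> requires the index type to be of class \<open>wellorder\<close>. Here the
  proportionality follows as in the uniqueness of Haar measure, by computing
  \<open>\<integral>\<integral> indicator A x * indicator S (x + g y)\<close> in both orders, with \<open>A\<close> the unit cube and
  \<open>g\<close> the inverse of \<open>f\<close>.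
\<close>

lemma measure_linear_image_compact:
  fixes f :: "'a::euclidean_space \<Rightarrow> 'a"
  assumes f: "linear f" "inj f" and "compact S"
  shows "measure lebesgue (f ` S) = measure lebesgue (f ` cbox 0 One) * measure lebesgue S"
proof -
  obtain g where g: "linear g" and gf: "\<And>x. g (f x) = x" and fg: "\<And>x. f (g x) = x"
    using linear_injective_isomorphism[OF f] by blast
  let ?A = "cbox 0 One :: 'a set"
  have lin: "bounded_linear f" "bounded_linear g"
    using f(1) g by (simp_all add: linear_conv_bounded_linear)
  note [measurable] = borel_measurable_continuous_onI[OF linear_continuous_on[OF lin(2)]]
  have [measurable]: "S \<in> sets borel" "?A \<in> sets borel"
    using \<open>compact S\<close> by (simp_all add: borel_compact)
  have fcomp: "compact (f ` T)" if "compact T" for T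
    using that linear_continuous_on[OF lin(1)] by (rule compact_continuous_image[rotated])
  \<comment> \<open>The case \<open>c = 1\<close> covers translations; \<open>c = - 1\<close> covers
    the reflection that appears when \<open>y\<close> enters through \<open>x - g y\<close>.\<close>
  have affine: "emeasure lborel ((\<lambda>y. c *\<^sub>R y + d) ` f ` T) = emeasure lebesgue (f ` T)"
    if "compact T" "\<bar>c\<bar> = 1" for T c d
  proof -
    have "compact ((\<lambda>y. c *\<^sub>R y + d) ` f ` T)"
      by (intro compact_continuous_image continuous_intros fcomp that)
    then have "emeasure lborel ((\<lambda>y. c *\<^sub>R y + d) ` f ` T) = emeasure lebesgue ((\<lambda>y. c *\<^sub>R y + d) ` f ` T)"
      by (simp add: borel_compact)
    then show ?thesis
      using emeasure_lebesgue_affine[of c d "f ` T"] that(2) by (simp add: add.commute)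
  qed
  let ?I = "\<lambda>T. indicator T :: 'a \<Rightarrow> ennreal"
  have "emeasure lebesgue (f ` S) * emeasure lborel ?A
      = (\<integral>\<^sup>+x. ?I ?A x * emeasure lebesgue (f ` S) \<partial>lborel)"
    by (subst nn_integral_multc) (simp_all add: mult.commute)
  also have "\<dots> = (\<integral>\<^sup>+x. \<integral>\<^sup>+y. ?I ?A x * ?I S (x + g y) \<partial>lborel \<partial>lborel)"
  proof (rule nn_integral_cong)
    fix x
    have "{y. x + g y \<in> S} = (\<lambda>y. 1 *\<^sub>R y + (- f x)) ` f ` S"
    proof (intro set_eqI iffI)
      fix y assume "y \<in> {y. x + g y \<in> S}"
      then show "y \<in> (\<lambda>y. 1 *\<^sub>R y + (- f x)) ` f ` S"
        using f(1) fg unfolding image_image by (intro image_eqI[of _ _ "x + g y"]) (auto simp: linear_add)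
    qed (use g gf in \<open>auto simp: linear_diff\<close>)
    then have "emeasure lebesgue (f ` S) = emeasure lborel {y. x + g y \<in> S}"
      using affine[OF \<open>compact S\<close>, of 1 "- f x"] by simp
    also have "\<dots> = (\<integral>\<^sup>+y. ?I {y. x + g y \<in> S} y \<partial>lborel)"
      by (rule nn_integral_indicator[symmetric]) measurable
    also have "\<dots> = (\<integral>\<^sup>+y. ?I S (x + g y) \<partial>lborel)"
      by (intro nn_integral_cong) (auto simp: indicator_def)
    finally show "?I ?A x * emeasure lebesgue (f ` S) = (\<integral>\<^sup>+y. ?I ?A x * ?I S (x + g y) \<partial>lborel)"
      by (simp add: nn_integral_cmult)
  qed
  also have "\<dots> = (\<integral>\<^sup>+y. \<integral>\<^sup>+x. ?I ?A x * ?I S (x + g y) \<partial>lborel \<partial>lborel)"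
    by (rule lborel_pair.Fubini') measurable
  \<comment> \<open>For fixed \<open>y\<close>, translation invariance replaces \<open>x\<close> by
    \<open>x - g y\<close>. Now \<open>S\<close> no longer depends on \<open>y\<close>, and the
    integral over \<open>y\<close> measures a reflected translate of the image of the cube.\<close>
  also have "\<dots> = (\<integral>\<^sup>+y. \<integral>\<^sup>+x. ?I ?A (x - g y) * ?I S x \<partial>lborel \<partial>lborel)"
  proof (rule nn_integral_cong)
    fix y
    have "(\<integral>\<^sup>+x. ?I ?A (x - g y) * ?I S x \<partial>lborel)
        = (\<integral>\<^sup>+x. ?I ?A (x - g y) * ?I S x \<partial>distr lborel borel ((+) (g y)))"
      by (simp only: lborel_distr_plus)
    also have "\<dots> = (\<integral>\<^sup>+x. ?I ?A x * ?I S (x + g y) \<partial>lborel)"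
      by (subst nn_integral_distr) (simp_all add: add.commute)
    finally show "(\<integral>\<^sup>+x. ?I ?A x * ?I S (x + g y) \<partial>lborel)
        = (\<integral>\<^sup>+x. ?I ?A (x - g y) * ?I S x \<partial>lborel)" ..
  qed
  also have "\<dots> = (\<integral>\<^sup>+x. \<integral>\<^sup>+y. ?I ?A (x - g y) * ?I S x \<partial>lborel \<partial>lborel)"
    by (rule lborel_pair.Fubini'[symmetric]) measurable
  also have "\<dots> = (\<integral>\<^sup>+x. emeasure lebesgue (f ` ?A) * ?I S x \<partial>lborel)"
  proof (rule nn_integral_cong)
    fix x
    have "{y. x - g y \<in> ?A} = (\<lambda>y. (- 1) *\<^sub>R y + f x) ` f ` ?A"
    proof (intro set_eqI iffI)
      fix y assume "y \<in> {y. x - g y \<in> ?A}"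
      then show "y \<in> (\<lambda>y. (- 1) *\<^sub>R y + f x) ` f ` ?A"
        using f(1) fg unfolding image_image by (intro image_eqI[of _ _ "x - g y"]) (auto simp: linear_diff)
    qed (use g gf in \<open>auto simp: linear_diff\<close>)
    then have "emeasure lebesgue (f ` ?A) = emeasure lborel {y. x - g y \<in> ?A}"
      using affine[of ?A "- 1" "f x"] by simp
    also have "\<dots> = (\<integral>\<^sup>+y. ?I {y. x - g y \<in> ?A} y \<partial>lborel)"
      by (rule nn_integral_indicator[symmetric]) measurable
    also have "\<dots> = (\<integral>\<^sup>+y. ?I ?A (x - g y) \<partial>lborel)"
      by (intro nn_integral_cong) (auto simp: indicator_def)
    finally show "(\<integral>\<^sup>+y. ?I ?A (x - g y) * ?I S x \<partial>lborel) = emeasure lebesgue (f ` ?A) * ?I S x"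
      by (simp add: nn_integral_multc)
  qed
  also have "\<dots> = emeasure lebesgue (f ` ?A) * emeasure lebesgue S"
    by (simp add: nn_integral_cmult)
  \<comment> \<open>The factor \<open>emeasure lborel ?A\<close> on the left is 1.\<close>
  finally have "emeasure lebesgue (f ` S) = emeasure lebesgue (f ` ?A) * emeasure lebesgue S"
    by (simp add: emeasure_lborel_cbox_eq)
  then show ?thesis
    by (simp add: measure_def enn2real_mult)
qed

section \<open>Hausdorff convergence\<close>

text \<open>For non-empty compact sets this says that the Hausdorff distance is less than
  \<open>e\<close>; the pointwise form avoids suprema and infima.\<close>

definition hausdorff_close :: "real \<Rightarrow> 'a::metric_space set \<Rightarrow> 'a set \<Rightarrow> bool" where
  "hausdorff_close e A B \<longleftrightarrow>
     (\<forall>x\<in>A. \<exists>y\<in>B. dist x y < e) \<and> (\<forall>y\<in>B. \<exists>x\<in>A. dist x y < e)"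

definition hausdorff_tendsto :: "(nat \<Rightarrow> 'a::metric_space set) \<Rightarrow> 'a set \<Rightarrow> bool" where
  "hausdorff_tendsto A B \<longleftrightarrow> (\<forall>e>0. \<forall>\<^sub>F k in sequentially. hausdorff_close e (A k) B)"

lemma hausdorff_tendsto_subseq:
  "hausdorff_tendsto A B \<Longrightarrow> strict_mono r \<Longrightarrow> hausdorff_tendsto (\<lambda>k. A (r k)) B"
  unfolding hausdorff_tendsto_def
proof (intro allI impI)
  fix e :: real assume "\<forall>e>0. \<forall>\<^sub>F k in sequentially. hausdorff_close e (A k) B" "strict_mono r" "e > 0"
  then have "\<forall>\<^sub>F k in sequentially. hausdorff_close e (A k) B"
    by blast
  then show "\<forall>\<^sub>F k in sequentially. hausdorff_close e (A (r k)) B"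
    by (rule eventually_subseq[OF \<open>strict_mono r\<close>])
qed

text \<open>The point \<open>x\<close> has points of \<open>B\<close> arbitrarily near, hence lies
  in the closure of \<open>B\<close>. This carries the normalization over to the limit
  bodies.\<close>

lemma hausdorff_tendsto_mem:
  assumes "hausdorff_tendsto A B" "closed B" "\<And>k. x \<in> A k"
  shows "x \<in> B"
proof -
  have "\<exists>y\<in>B. dist y x < e" if "e > 0" for e
  proof -
    have "\<forall>\<^sub>F k in sequentially. hausdorff_close e (A k) B"
      using assms(1) that by (simp add: hausdorff_tendsto_def)
    then obtain k where "hausdorff_close e (A k) B"
      using eventually_happens'[OF sequentially_bot] by blast
    then show ?thesis
      using assms(3)[of k] by (metis hausdorff_close_def dist_commute)
  qed
  then have "x \<in> closure B"
    by (simp add: closure_approachable)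
  then show ?thesis
    using assms(2) by simp
qed

lemma hausdorff_tendsto_scaleR:
  fixes A :: "nat \<Rightarrow> 'a::real_normed_vector set"
  assumes "hausdorff_tendsto A B"
  shows "hausdorff_tendsto (\<lambda>k. (\<lambda>x. c *\<^sub>R x) ` A k) ((\<lambda>x. c *\<^sub>R x) ` B)"
  unfolding hausdorff_tendsto_def
proof (intro allI impI)
  fix e :: real assume "e > 0"
  \<comment> \<open>Adding 1 keeps the denominator positive for \<open>c = 0\<close>.\<close>
  then have "e / (\<bar>c\<bar> + 1) > 0"
    by simp
  with assms have "\<forall>\<^sub>F k in sequentially. hausdorff_close (e / (\<bar>c\<bar> + 1)) (A k) B"
    by (simp add: hausdorff_tendsto_def)
  then show "\<forall>\<^sub>F k in sequentially. hausdorff_close e ((\<lambda>x. c *\<^sub>R x) ` A k) ((\<lambda>x. c *\<^sub>R x) ` B)"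
  proof eventually_elim
    case (elim k)
    have "dist (c *\<^sub>R x) (c *\<^sub>R y) < e" if "dist x y < e / (\<bar>c\<bar> + 1)" for x y :: 'a
    proof -
      have "dist (c *\<^sub>R x) (c *\<^sub>R y) = \<bar>c\<bar> * dist x y"
        by (simp add: dist_norm flip: scaleR_diff_right)
      also have "\<dots> \<le> dist x y * (\<bar>c\<bar> + 1)"
        by (simp add: algebra_simps)
      also have "\<dots> < e"
        using that by (simp add: pos_less_divide_eq)
      finally show ?thesis .
    qed
    with elim show ?case
      unfolding hausdorff_close_def by blast
  qed
qed

lemma hausdorff_tendsto_plus:
  fixes A :: "nat \<Rightarrow> 'a::real_normed_vector set"
  assumes "hausdorff_tendsto A B" "hausdorff_tendsto A' B'"
  shows "hausdorff_tendsto (\<lambda>k. A k + A' k) (B + B')"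
  unfolding hausdorff_tendsto_def
proof (intro allI impI)
  fix e :: real assume "e > 0"
  with assms have "\<forall>\<^sub>F k in sequentially. hausdorff_close (e/2) (A k) B"
      "\<forall>\<^sub>F k in sequentially. hausdorff_close (e/2) (A' k) B'"
    by (simp_all add: hausdorff_tendsto_def)
  then show "\<forall>\<^sub>F k in sequentially. hausdorff_close e (A k + A' k) (B + B')"
  proof eventually_elim
    case (elim k)
    have *: "dist (x + x') (y + y') < e" if "dist x y < e/2" "dist x' y' < e/2" for x y x' y' :: 'a
      using that dist_triangle_add[of x x' y y'] by linarith
    show ?case
      unfolding hausdorff_close_def
    proof (intro conjI ballI)
      fix z assume "z \<in> A k + A' k"
      then obtain x x' where z: "z = x + x'" "x \<in> A k" "x' \<in> A' k"
        by (rule set_plus_elim)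
      with elim obtain y y' where "y \<in> B" "y' \<in> B'" "dist x y < e/2" "dist x' y' < e/2"
        unfolding hausdorff_close_def by meson
      then show "\<exists>w\<in>B + B'. dist z w < e"
        using z(1) * by (intro bexI[of _ "y + y'"]) (auto intro: set_plus_intro)
    next
      fix w assume "w \<in> B + B'"
      then obtain y y' where w: "w = y + y'" "y \<in> B" "y' \<in> B'"
        by (rule set_plus_elim)
      with elim obtain x x' where "x \<in> A k" "x' \<in> A' k" "dist x y < e/2" "dist x' y' < e/2"
        unfolding hausdorff_close_def by meson
      then show "\<exists>z\<in>A k + A' k. dist z w < e"
        using w(1) * by (intro bexI[of _ "x + x'"]) (auto intro: set_plus_intro)
    qed
  qed
qed

text \<open>If every point of \<open>S\<close> has a point of \<open>T\<close> within
  \<open>e/2\<close>, the triangle inequality gives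
  \<open>infdist x T \<le> infdist x S + e/2\<close>; this is applied in both directions.\<close>

lemma hausdorff_tendsto_infdist:
  assumes "hausdorff_tendsto A B" "\<And>k. A k \<noteq> {}" "B \<noteq> {}"
  shows "(\<lambda>k. infdist x (A k)) \<longlonglongrightarrow> infdist x B"
proof (rule LIMSEQ_I)
  fix e :: real assume "e > 0"
  have le: "infdist x T \<le> infdist x S + e/2"
    if "S \<noteq> {}" and near: "\<And>y. y \<in> S \<Longrightarrow> \<exists>z\<in>T. dist y z < e/2" for S T :: "'a set"
  proof -
    have "infdist x T - e/2 \<le> infdist x S"
      unfolding infdist_notempty[OF \<open>S \<noteq> {}\<close>]
    proof (rule cINF_greatest[OF \<open>S \<noteq> {}\<close>])
      fix y assume "y \<in> S"
      then obtain z where "z \<in> T" "dist y z < e/2" using near by blast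
      then show "infdist x T - e/2 \<le> dist x y"
        using infdist_le[of z T x] dist_triangle[of x z y] by linarith
    qed
    then show ?thesis by simp
  qed
  have "\<forall>\<^sub>F k in sequentially. hausdorff_close (e/2) (A k) B"
    using assms(1) \<open>e > 0\<close> by (simp add: hausdorff_tendsto_def)
  then have "\<forall>\<^sub>F k in sequentially. norm (infdist x (A k) - infdist x B) < e"
  proof eventually_elim
    case (elim k)
    then have "infdist x B \<le> infdist x (A k) + e/2" "infdist x (A k) \<le> infdist x B + e/2"
      by (intro le assms; auto simp: hausdorff_close_def; metis dist_commute)+
    then show ?case using \<open>e > 0\<close> by (simp add: abs_if)
  qed
  then show "\<exists>no. \<forall>n\<ge>no. norm (infdist x (A n) - infdist x B) < e"
    by (simp add: eventually_sequentially)
qed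

section \<open>Blaschke's selection theorem\<close>

text \<open>The distance functions of the sets \<open>A k\<close> are 1-Lipschitz and uniformly
  bounded, so Arzela-Ascoli gives a uniformly convergent subsequence on a compact set. The limit set
  is the zero set of the limit function \<open>g\<close>.\<close>

theorem blaschke_selection:
  fixes A :: "nat \<Rightarrow> 'a::euclidean_space set"
  assumes S: "compact S" and A: "\<And>k. A k \<subseteq> S" "\<And>k. closed (A k)" "\<And>k. convex (A k)" "\<And>k. A k \<noteq> {}"
  shows "\<exists>B r. strict_mono (r :: nat \<Rightarrow> nat) \<and> compact B \<and> convex B \<and> B \<noteq> {} \<and>
    hausdorff_tendsto (\<lambda>k. A (r k)) B"
proof -
  \<comment> \<open>The functions converge only on the compact set chosen here; its convexity keeps
    convex combinations of points of \<open>B\<close> inside it.\<close>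
  define T where "T = convex hull S"
  have T: "compact T" "convex T" "\<And>k. A k \<subseteq> T"
    using S A(1) hull_subset[of S convex] by (auto simp: T_def compact_convex_hull)
  obtain b where b: "\<And>x. x \<in> T \<Longrightarrow> norm x \<le> b"
    using T(1) compact_imp_bounded bounded_iff by metis
  have bound: "norm (infdist x (A k)) \<le> 2 * b" if "x \<in> T" for x k
  proof -
    obtain a where "a \<in> A k" using A(4) by blast
    then have "infdist x (A k) \<le> norm x + norm a"
      using infdist_le[of a "A k" x] norm_triangle_ineq4[of x a] by (simp add: dist_norm)
    also have "\<dots> \<le> 2 * b" using b[OF that] b[of a] T(3) \<open>a \<in> A k\<close> by fastforce
    finally show ?thesis by (simp add: infdist_nonneg)
  qed
  have equi: "\<exists>d>0. \<forall>k y. y \<in> T \<and> norm (x - y) < d \<longrightarrow> norm (infdist x (A k) - infdist y (A k)) < e"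
    if "e > 0" for x e
    using that infdist_triangle_abs by (metis dist_norm le_less_trans real_norm_def)
  obtain g r where g: "continuous_on T g" and r: "strict_mono (r :: nat \<Rightarrow> nat)"
    and lim: "\<And>e. 0 < e \<Longrightarrow> \<exists>N. \<forall>k x. k \<ge> N \<and> x \<in> T \<longrightarrow> norm (infdist x (A (r k)) - g x) < e"
    using Arzela_Ascoli[OF T(1) bound equi] by metis
  define B where "B = {x \<in> T. g x = 0}"
  have ptlim: "(\<lambda>k. infdist x (A (r k))) \<longlonglongrightarrow> g x" if "x \<in> T" for x
    using lim that by (intro LIMSEQ_I) blast
  have g0: "g x \<ge> 0" if "x \<in> T" for x
    using ptlim[OF that] by (rule LIMSEQ_le_const) (auto simp: infdist_nonneg)
  have "closed B"
    using continuous_closed_preimage_constant[OF g] T(1) by (simp add: B_def compact_imp_closed)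
  moreover have "bounded B"
    using T(1) by (rule bounded_subset[OF compact_imp_bounded]) (auto simp: B_def)
  ultimately have "compact B"
    by (simp add: compact_eq_bounded_closed)
  have "convex B"
    unfolding convex_def
  proof (intro ballI allI impI)
    fix x y and u v :: real assume xy: "x \<in> B" "y \<in> B" and uv: "0 \<le> u" "0 \<le> v" "u + v = 1"
    define z where "z = u *\<^sub>R x + v *\<^sub>R y"
    have "z \<in> T"
      using xy uv T(2) by (auto simp: B_def z_def convex_def)
    \<comment> \<open>The distance to a convex set is a convex function. In the limit
      \<open>g\<close> inherits this, so its zero set is convex.\<close>
    have "infdist z (A k) \<le> u * infdist x (A k) + v * infdist y (A k)" for k
    proof -
      obtain a a' where a: "a \<in> A k" "infdist x (A k) = dist x a" "a' \<in> A k" "infdist y (A k) = dist y a'"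
        using infdist_attains_inf[OF A(2,4)] by metis
      have "u *\<^sub>R a + v *\<^sub>R a' \<in> A k"
        using a uv A(3) by (auto simp: convex_def)
      then have "infdist z (A k) \<le> norm (u *\<^sub>R (x - a) + v *\<^sub>R (y - a'))"
        using infdist_le[of "u *\<^sub>R a + v *\<^sub>R a'" "A k" z] by (simp add: z_def dist_norm algebra_simps)
      also have "\<dots> \<le> u * norm (x - a) + v * norm (y - a')"
        using norm_triangle_ineq[of "u *\<^sub>R (x - a)" "v *\<^sub>R (y - a')"] uv by simp
      finally show ?thesis using a by (simp add: dist_norm)
    qed
    moreover have "(\<lambda>k. u * infdist x (A (r k)) + v * infdist y (A (r k))) \<longlonglongrightarrow> u * g x + v * g y"
      using xy by (intro tendsto_intros ptlim) (auto simp: B_def)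
    ultimately have "g z \<le> u * g x + v * g y"
      using ptlim[OF \<open>z \<in> T\<close>] by (auto intro: LIMSEQ_le)
    then show "z \<in> B"
      using xy g0[OF \<open>z \<in> T\<close>] \<open>z \<in> T\<close> by (simp add: B_def)
  qed
  \<comment> \<open>The distance to \<open>A (r k)\<close> vanishes on \<open>A (r k)\<close>, so
    uniform convergence makes \<open>g\<close> small there.\<close>
  have gsmall: "\<forall>\<^sub>F k in sequentially. \<forall>x\<in>A (r k). g x < d" if "d > 0" for d
  proof -
    obtain N where N: "\<And>k x. k \<ge> N \<Longrightarrow> x \<in> T \<Longrightarrow> norm (infdist x (A (r k)) - g x) < d"
      using lim[OF \<open>d > 0\<close>] by blast
    have "g x < d" if "k \<ge> N" "x \<in> A (r k)" for k x
      using N[of k x] that T(3) by (fastforce simp: abs_if split: if_splits)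
    then show ?thesis
      by (auto simp: eventually_sequentially)
  qed
  have near: "\<forall>\<^sub>F k in sequentially. \<forall>x\<in>A (r k). \<exists>y\<in>B. dist x y < e" if "e > 0" for e
  proof -
    \<comment> \<open>On the part of \<open>T\<close> at distance at least \<open>e\<close> from
      \<open>B\<close>, \<open>g\<close> is positive and, by compactness, bounded below by some
      \<open>d > 0\<close>. Once \<open>g\<close> is below \<open>d\<close> on
      \<open>A (r k)\<close>, that set misses \<open>C\<close>.\<close>
    define C where "C = T - (\<Union>y\<in>B. ball y e)"
    have "\<exists>d>0. \<forall>x\<in>C. g x \<ge> d"
    proof (cases "C = {}")
      case False
      have "compact C"
        unfolding C_def by (intro compact_diff T(1)) auto
      moreover have "continuous_on C g"
        using g by (rule continuous_on_subset) (auto simp: C_def)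
      ultimately obtain c where c: "c \<in> C" "\<And>x. x \<in> C \<Longrightarrow> g c \<le> g x"
        using continuous_attains_inf False by metis
      have "c \<in> T" "c \<notin> B"
        using c(1) \<open>e > 0\<close> by (auto simp: C_def)
      then have "g c > 0"
        using g0[of c] by (auto simp: B_def)
      then show ?thesis using c by blast
    qed (auto intro: exI[of _ 1])
    then obtain d where d: "d > 0" "\<And>x. x \<in> C \<Longrightarrow> g x \<ge> d" by blast
    from gsmall[OF d(1)] show ?thesis
    proof eventually_elim
      case (elim k)
      show ?case
      proof
        fix x assume "x \<in> A (r k)"
        with elim d(2) have "x \<notin> C" by fastforce
        then show "\<exists>y\<in>B. dist x y < e"
          using \<open>x \<in> A (r k)\<close> T(3) by (auto simp: C_def dist_commute)
      qed
    qed
  qed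
  have "B \<noteq> {}"
  proof -
    obtain k where "\<forall>x\<in>A (r k). \<exists>y\<in>B. dist x y < 1"
      using eventually_happens[OF near[of 1]] by auto
    then show ?thesis using A(4)[of "r k"] by blast
  qed
  have "hausdorff_tendsto (\<lambda>k. A (r k)) B"
    unfolding hausdorff_tendsto_def
  proof (intro allI impI)
    fix e :: real assume "e > 0"
    obtain N where N: "\<And>k x. k \<ge> N \<Longrightarrow> x \<in> T \<Longrightarrow> norm (infdist x (A (r k)) - g x) < e"
      using lim[OF \<open>e > 0\<close>] by blast
    have "\<exists>x\<in>A (r k). dist x y < e" if "k \<ge> N" "y \<in> B" for k y
    proof -
      have "infdist y (A (r k)) < e"
        using N[of k y] that by (simp add: B_def infdist_nonneg)
      moreover obtain x where "x \<in> A (r k)" "infdist y (A (r k)) = dist y x"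
        using infdist_attains_inf[OF A(2,4)] by metis
      ultimately show ?thesis by (metis dist_commute)
    qed
    then have "\<forall>\<^sub>F k in sequentially. \<forall>y\<in>B. \<exists>x\<in>A (r k). dist x y < e"
      unfolding eventually_sequentially by blast
    with near[OF \<open>e > 0\<close>] show "\<forall>\<^sub>F k in sequentially. hausdorff_close e (A (r k)) B"
      by eventually_elim (simp add: hausdorff_close_def)
  qed
  with r \<open>compact B\<close> \<open>convex B\<close> \<open>B \<noteq> {}\<close> show ?thesis by blast
qed

section \<open>Continuity of volume\<close>

text \<open>If \<open>A k\<close> missed \<open>x\<close>, a hyperplane would separate them, and a
  ball around \<open>x\<close> inside \<open>B\<close> would reach too far beyond the hyperplane for
  \<open>A k\<close> to be close to \<open>B\<close>.\<close>

lemma hausdorff_tendsto_interior: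
  fixes A :: "nat \<Rightarrow> 'a::euclidean_space set"
  assumes lim: "hausdorff_tendsto A B" and A: "\<And>k. closed (A k)" "\<And>k. convex (A k)" "\<And>k. A k \<noteq> {}"
    and x: "x \<in> interior B"
  shows "\<forall>\<^sub>F k in sequentially. x \<in> A k"
proof -
  obtain e where e: "e > 0" "cball x e \<subseteq> B"
    using x mem_interior_cball by blast
  have "\<forall>\<^sub>F k in sequentially. hausdorff_close e (A k) B"
    using lim e(1) by (simp add: hausdorff_tendsto_def)
  then show ?thesis
  proof eventually_elim
    case (elim k)
    show ?case
    proof (rule ccontr)
      assume "x \<notin> A k"
      then obtain a c where ac: "a \<bullet> x < c" "\<And>y. y \<in> A k \<Longrightarrow> a \<bullet> y > c"
        using separating_hyperplane_closed_point[OF A(2,1)] by blast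
      then have "a \<noteq> 0"
        using A(3)[of k] by (metis all_not_in_conv inner_zero_left less_asym)
      \<comment> \<open>The point of \<open>cball x e\<close> farthest from the half-space
        containing \<open>A k\<close>: any \<open>y\<close> within \<open>e\<close> of it satisfies
        \<open>a \<bullet> y < a \<bullet> x < c\<close>.\<close>
      define z where "z = x - (e / norm a) *\<^sub>R a"
      have "z \<in> B"
        using e \<open>a \<noteq> 0\<close> by (auto simp: z_def dist_norm intro!: subsetD[OF e(2)])
      then obtain y where y: "y \<in> A k" "dist y z < e"
        using elim by (auto simp: hausdorff_close_def)
      have "a \<bullet> (y - z) \<le> norm a * dist y z"
        using norm_cauchy_schwarz[of a "y - z"] by (simp add: dist_norm)
      also have "\<dots> < norm a * e"
        using y(2) \<open>a \<noteq> 0\<close> by simp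
      finally have "a \<bullet> y < a \<bullet> x"
        using \<open>a \<noteq> 0\<close>
        by (simp add: z_def inner_diff_right dot_square_norm power2_eq_square)
      with ac y(1) show False by fastforce
    qed
  qed
qed

text \<open>Dominated convergence for the indicator functions. They are eventually constant at
  interior points of \<open>B\<close> and at points outside \<open>B\<close>; what remains is the
  frontier, a null set by convexity.\<close>

lemma hausdorff_tendsto_measure:
  fixes A :: "nat \<Rightarrow> 'a::euclidean_space set"
  assumes lim: "hausdorff_tendsto A B" and S: "bounded S" "\<And>k. A k \<subseteq> S"
    and A: "\<And>k. closed (A k)" "\<And>k. convex (A k)" "\<And>k. A k \<noteq> {}"
    and B: "compact B" "convex B" "B \<noteq> {}"
  shows "(\<lambda>k. measure lebesgue (A k)) \<longlonglongrightarrow> measure lebesgue B"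
proof -
  have Aleb: "A k \<in> sets lebesgue" for k
    using A(1) by simp
  have Bleb: "B \<in> sets lebesgue"
    using B(1) by (simp add: compact_imp_closed)
  have Sleb: "closure S \<in> lmeasurable"
    using S(1) by (simp add: lmeasurable_compact compact_closure)
  have "(\<lambda>k. \<integral>x. indicat_real (A k) x \<partial>lebesgue) \<longlonglongrightarrow> (\<integral>x. indicat_real B x \<partial>lebesgue)"
  \<comment> \<open>The closure makes the bounded set \<open>S\<close> measurable, with finite
    measure.\<close>
  proof (rule integral_dominated_convergence[where w = "indicat_real (closure S)"])
    have "frontier B \<in> null_sets lebesgue"
      using negligible_convex_frontier[OF B(2)] by (simp add: negligible_iff_null_sets)
    then show "AE x in lebesgue. (\<lambda>k. indicat_real (A k) x) \<longlonglongrightarrow> indicat_real B x"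
    proof (rule AE_I'[where N = "frontier B"], intro subsetI)
      fix x assume nl: "x \<in> {x \<in> space lebesgue. \<not> (\<lambda>k. indicat_real (A k) x) \<longlonglongrightarrow> indicat_real B x}"
      show "x \<in> frontier B"
      proof (rule ccontr)
        assume "x \<notin> frontier B"
        then consider "x \<in> interior B" | "x \<notin> B"
          using B(1) by (auto simp: frontier_def compact_imp_closed)
        then have "\<forall>\<^sub>F k in sequentially. indicat_real (A k) x = indicat_real B x"
        proof cases
          case 1
          then have "x \<in> B" using interior_subset by blast
          with hausdorff_tendsto_interior[OF lim A 1] show ?thesis
            by (auto elim: eventually_mono)
        next
          case 2
          then have "infdist x B > 0"
            using B by (intro infdist_pos_not_in_closed) (auto simp: compact_imp_closed)
          then have "\<forall>\<^sub>F k in sequentially. infdist x (A k) > 0"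
            by (rule order_tendstoD(1)[OF hausdorff_tendsto_infdist[OF lim A(3) B(3)]])
          then show ?thesis
            by eventually_elim (use 2 in \<open>auto simp: indicator_def\<close>)
        qed
        then show False
          using nl by (auto intro: tendsto_eventually)
      qed
    qed
    show "AE x in lebesgue. norm (indicat_real (A k) x) \<le> indicat_real (closure S) x" for k
      using S(2)[of k] closure_subset[of S] by (auto simp: indicator_def)
  qed (use Aleb Bleb Sleb in \<open>auto simp: fmeasurable_def\<close>)
  then show ?thesis by simp
qed

section \<open>Convex bodies and affine images\<close>

lemma compact_set_plus:
  fixes S T :: "'a::real_normed_vector set"
  assumes "compact S" "compact T"
  shows "compact (S + T)"
proof -
  have "S + T = {x + y | x y. x \<in> S \<and> y \<in> T}"
    by (auto simp: set_plus_def)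
  then show ?thesis
    using compact_sums[OF assms] by simp
qed

lemma convex_body_plus:
  fixes K E :: "(real ^ 'n::finite) set"
  assumes "convex_body K" "convex_body E"
  shows "convex_body (K + E)"
proof -
  have "compact (K + E)"
    using assms by (intro compact_set_plus) (simp_all add: convex_body_def)
  moreover have "convex (K + E)"
    using assms by (intro convex_set_plus) (simp_all add: convex_body_def)
  moreover obtain x y where "x \<in> K" "y \<in> E"
    using assms by (auto simp: convex_body_def)
  then have "x + y \<in> K + E"
    by (rule set_plus_intro)
  ultimately show ?thesis
    unfolding convex_body_def by blast
qed

lemma convex_body_scaleR:
  fixes E :: "(real ^ 'n::finite) set"
  assumes "convex_body E"
  shows "convex_body ((\<lambda>x. l *\<^sub>R x) ` E)"
proof -
  have "compact ((\<lambda>x. l *\<^sub>R x) ` E)"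
    using assms by (intro compact_scaling) (simp add: convex_body_def)
  moreover have "convex ((\<lambda>x. l *\<^sub>R x) ` E)"
    using assms by (intro convex_scaling) (simp add: convex_body_def)
  moreover have "(\<lambda>x. l *\<^sub>R x) ` E \<noteq> {}"
    using assms by (simp add: convex_body_def)
  ultimately show ?thesis
    unfolding convex_body_def by blast
qed

lemma convex_body_linear_image_translation:
  assumes "convex_body K" "linear f"
  shows "convex_body (f ` (\<lambda>x. x - a) ` K)"
proof -
  have "compact (f ` (\<lambda>x. x - a) ` K)"
    using assms
    by (intro compact_continuous_image linear_continuous_on compact_translation_subtract)
      (simp_all add: linear_conv_bounded_linear convex_body_def)
  moreover have "convex (f ` (\<lambda>x. x - a) ` K)"
    using assms by (intro convex_linear_image[OF assms(2)] convex_translation_subtract)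
      (simp add: convex_body_def)
  ultimately show ?thesis
    using assms(1) by (simp add: convex_body_def)
qed

text \<open>The translations shift \<open>K + l E\<close> by \<open>a + l b\<close>, which leaves
  its volume unchanged, and \<open>f\<close> multiplies it by the volume of the image of the unit
  cube. This factor does not depend on \<open>l\<close>, so all coefficients scale alike.\<close>

lemma relative_quermassintegrals_affine_image:
  fixes f :: "real ^ 'n::finite \<Rightarrow> real ^ 'n"
  assumes KE: "convex_body K" "convex_body E" and f: "linear f" "inj f"
    and W: "relative_quermassintegrals K E W"
  shows "relative_quermassintegrals (f ` (\<lambda>x. x - a) ` K) (f ` (\<lambda>x. x - b) ` E)
           (\<lambda>i. measure lebesgue (f ` cbox 0 One) * W i)"
  unfolding relative_quermassintegrals_def
proof (intro allI impI)
  fix l :: real assume "l \<ge> 0"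
  let ?M = "K + (\<lambda>x. l *\<^sub>R x) ` E"
  have "f (x - a) + l *\<^sub>R f (y - b) = f (x + l *\<^sub>R y - (a + l *\<^sub>R b))" for x y
    using f(1) by (simp add: linear_diff linear_add linear_scale algebra_simps)
  then have "f ` (\<lambda>x. x - a) ` K + (\<lambda>x. l *\<^sub>R x) ` f ` (\<lambda>x. x - b) ` E = f ` (\<lambda>x. x - (a + l *\<^sub>R b)) ` ?M"
    by (auto simp: set_plus_def image_iff; metis)
  moreover have comp: "compact ((\<lambda>x. x - (a + l *\<^sub>R b)) ` ?M)"
    using convex_body_plus[OF KE(1) convex_body_scaleR[OF KE(2), of l]]
    by (intro compact_translation_subtract) (simp add: convex_body_def)
  moreover have "measure lebesgue ?M = (\<Sum>i\<le>CARD('n). real (CARD('n) choose i) * W i * l ^ i)"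
    using W \<open>l \<ge> 0\<close> by (simp add: relative_quermassintegrals_def)
  ultimately show "measure lebesgue (f ` (\<lambda>x. x - a) ` K + (\<lambda>x. l *\<^sub>R x) ` f ` (\<lambda>x. x - b) ` E) =
      (\<Sum>i\<le>CARD('n). real (CARD('n) choose i) * (measure lebesgue (f ` cbox 0 One) * W i) * l ^ i)"
    using measure_linear_image_compact[OF f] comp
    by (simp only: measure_translation_subtract sum_distrib_left mult_ac)
qed

section \<open>Normalized witnesses and closedness\<close>

lemma mem_steiner_roots_iff:
  "z \<in> steiner_roots TYPE('n::finite) \<longleftrightarrow> Im z \<ge> 0 \<and>
     (\<exists>(K :: (real ^ 'n) set) E W. convex_body K \<and> convex_body E \<and> aff_dim (K + E) = int CARD('n) \<and>
        relative_quermassintegrals K E W \<and>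
        (\<Sum>i\<le>CARD('n). of_real (real (CARD('n) choose i) * W i) * z ^ i) = 0)"
proof -
  have *: "(\<Sum>i\<le>CARD('n). of_real (real (CARD('n) choose i) * W i) * z ^ i) =
      poly (\<Sum>i\<le>CARD('n). monom (of_real (real (CARD('n) choose i) * W i)) i) z" for W
    by (simp add: poly_sum poly_monom)
  show ?thesis
    unfolding steiner_roots_def relative_steiner_polynomial_def mem_Collect_eq * by blast
qed

text \<open>Full dimension is expressed by membership of the origin and the unit vectors, a
  condition that survives Hausdorff limits, whereas full dimension alone can be lost.\<close>

definition normalized_witness ::
  "complex \<Rightarrow> (real ^ 'n::finite) set \<Rightarrow> (real ^ 'n) set \<Rightarrow> (nat \<Rightarrow> real) \<Rightarrow> bool" where
  "normalized_witness z K E W \<longleftrightarrow> convex_body K \<and> convex_body E \<and>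
     K \<subseteq> cbox (- 1) 1 \<and> E \<subseteq> cbox (- 1) 1 \<and> 0 \<in> K + E \<and> (\<forall>i. axis i 1 \<in> K + E) \<and>
     relative_quermassintegrals K E W \<and>
     (\<Sum>i\<le>CARD('n). of_real (real (CARD('n) choose i) * W i) * z ^ i) = 0"

lemma steiner_root_normalized:
  assumes "z \<in> steiner_roots TYPE('n::finite)"
  shows "\<exists>(K :: (real ^ 'n) set) E W. normalized_witness z K E W"
proof -
  obtain K E :: "(real ^ 'n) set" and W where KE: "convex_body K" "convex_body E"
    and dim: "aff_dim (K + E) = int CARD('n)"
    and W: "relative_quermassintegrals K E W"
    and root: "(\<Sum>i\<le>CARD('n). of_real (real (CARD('n) choose i) * W i) * z ^ i) = 0"
    using assms by (auto simp: mem_steiner_roots_iff)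
  obtain a b where ab: "a \<in> K" "b \<in> E"
    using KE by (auto simp: convex_body_def)
  define D where "D = (\<lambda>x. x - (a + b)) ` (K + E)"
  have "compact D"
    using convex_body_plus[OF KE]
    unfolding D_def by (intro compact_translation_subtract) (simp add: convex_body_def)
  moreover have "0 \<in> D"
    using ab by (auto simp: D_def intro!: image_eqI[of _ _ "a + b"] set_plus_intro)
  moreover have "aff_dim D = int CARD('n)"
    using dim by (simp add: D_def aff_dim_translation_eq_subtract)
  ultimately obtain f :: "real ^ 'n \<Rightarrow> real ^ 'n" where f: "linear f" "inj f"
    "f ` D \<subseteq> cbox (- 1) 1" "\<And>i. axis i 1 \<in> f ` D"
    by (rule exists_normalizing_linear_map) blast
  let ?K = "f ` (\<lambda>x. x - a) ` K" and ?E = "f ` (\<lambda>x. x - b) ` E"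
  have "f (x - a) + f (y - b) = f (x + y - (a + b))" for x y
    using f(1) by (simp add: linear_diff linear_add algebra_simps)
  then have sum: "?K + ?E = f ` D"
    by (auto simp: D_def set_plus_def image_iff; metis)
  have "f 0 = 0"
    using f(1) by (rule linear_0)
  then have "0 \<in> ?K" "0 \<in> ?E"
    using ab by force+
  then have "?K \<subseteq> ?K + ?E" "?E \<subseteq> ?K + ?E"
    using set_zero_plus2[of ?K ?E] set_zero_plus2[of ?E ?K] by (simp_all add: add.commute)
  then have "?K \<subseteq> cbox (- 1) 1" "?E \<subseteq> cbox (- 1) 1"
    using f(3) unfolding sum by blast+
  moreover have "(\<Sum>i\<le>CARD('n). of_real (real (CARD('n) choose i) * (measure lebesgue (f ` cbox 0 One) * W i)) * z ^ i) = 0"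
  proof -
    have "(\<Sum>i\<le>CARD('n). of_real (real (CARD('n) choose i) * (measure lebesgue (f ` cbox 0 One) * W i)) * z ^ i) =
        of_real (measure lebesgue (f ` cbox 0 One)) * (\<Sum>i\<le>CARD('n). of_real (real (CARD('n) choose i) * W i) * z ^ i)"
      unfolding sum_distrib_left by (intro sum.cong) (auto simp: algebra_simps)
    then show ?thesis using root by simp
  qed
  moreover have "0 \<in> f ` D"
    using \<open>f 0 = 0\<close> \<open>0 \<in> D\<close> by force
  moreover have "relative_quermassintegrals ?K ?E (\<lambda>i. measure lebesgue (f ` cbox 0 One) * W i)"
    by (rule relative_quermassintegrals_affine_image[OF KE f(1,2) W])
  moreover have "convex_body ?K" "convex_body ?E"
    using KE f(1) by (simp_all add: convex_body_linear_image_translation)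
  ultimately show ?thesis
    using f(4) unfolding normalized_witness_def sum[symmetric] by blast
qed

theorem theorem1p2:
  assumes "CARD('n::finite) \<ge> 2"
  shows "closed (steiner_roots TYPE('n))"
  unfolding closed_sequential_limits
proof (intro allI impI, elim conjE)
  fix \<zeta> z assume roots: "\<forall>k. \<zeta> k \<in> steiner_roots TYPE('n)" and "\<zeta> \<longlonglongrightarrow> z"
  let ?n = "CARD('n)" and ?Q = "cbox (- 1) 1 :: (real ^ 'n) set"
  have "\<forall>k. \<exists>(K :: (real ^ 'n) set) E W. normalized_witness (\<zeta> k) K E W"
    using roots steiner_root_normalized by blast
  then obtain K E :: "nat \<Rightarrow> (real ^ 'n) set" and W where
    "\<And>k. normalized_witness (\<zeta> k) (K k) (E k) (W k)"
    by metis
  then have KE: "\<And>k. convex_body (K k)" "\<And>k. convex_body (E k)" "\<And>k. K k \<subseteq> ?Q" "\<And>k. E k \<subseteq> ?Q"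
    and zero: "\<And>k. 0 \<in> K k + E k" and ax: "\<And>k i. axis i 1 \<in> K k + E k"
    and W: "\<And>k. relative_quermassintegrals (K k) (E k) (W k)"
    and root: "\<And>k. (\<Sum>i\<le>?n. of_real (real (?n choose i) * W k i) * \<zeta> k ^ i) = 0"
    unfolding normalized_witness_def by blast+
  have Kprops: "closed (K k)" "convex (K k)" "K k \<noteq> {}" and Eprops: "closed (E k)" "convex (E k)" "E k \<noteq> {}" for k
    using KE(1,2)[of k] by (auto simp: convex_body_def compact_imp_closed)
  obtain K' r where r: "strict_mono r" and K': "compact K'" "convex K'" "K' \<noteq> {}"
    and limK: "hausdorff_tendsto (\<lambda>k. K (r k)) K'"
    using blaschke_selection[of ?Q K, OF compact_cbox KE(3) Kprops] by blast
  \<comment> \<open>The second selection runs along the first subsequence, so both bodies converge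
    along \<open>r \<circ> s\<close>.\<close>
  obtain E' s where s: "strict_mono s" and E': "compact E'" "convex E'" "E' \<noteq> {}"
    and limE: "hausdorff_tendsto (\<lambda>k. E (r (s k))) E'"
    using blaschke_selection[of ?Q "\<lambda>k. E (r k)", OF compact_cbox KE(4) Eprops] by blast
  define q where "q = r \<circ> s"
  have limK: "hausdorff_tendsto (\<lambda>k. K (q k)) K'"
    using hausdorff_tendsto_subseq[OF limK s] by (simp add: q_def)
  have limE: "hausdorff_tendsto (\<lambda>k. E (q k)) E'"
    using limE by (simp add: q_def)
  have KE': "convex_body K'" "convex_body E'"
    using K' E' by (simp_all add: convex_body_def)
  have vol: "(\<lambda>k. \<Sum>i\<le>?n. real (?n choose i) * W (q k) i * l ^ i)
      \<longlonglongrightarrow> measure lebesgue (K' + (\<lambda>x. l *\<^sub>R x) ` E')" if "l \<ge> 0" for l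
  proof -
    have body: "convex_body (K (q k) + (\<lambda>x. l *\<^sub>R x) ` E (q k))" for k
      by (intro convex_body_plus convex_body_scaleR KE)
    have body': "convex_body (K' + (\<lambda>x. l *\<^sub>R x) ` E')"
      by (intro convex_body_plus convex_body_scaleR KE')
    \<comment> \<open>For fixed \<open>l\<close> this set contains all the sums, as dominated
      convergence requires.\<close>
    have "bounded (?Q + (\<lambda>x. l *\<^sub>R x) ` ?Q)"
      by (intro compact_imp_bounded compact_set_plus compact_scaling compact_cbox)
    moreover have "K (q k) + (\<lambda>x. l *\<^sub>R x) ` E (q k) \<subseteq> ?Q + (\<lambda>x. l *\<^sub>R x) ` ?Q" for k
      by (intro set_plus_mono2 image_mono KE)
    moreover note hausdorff_tendsto_plus[OF limK hausdorff_tendsto_scaleR[OF limE]]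
    ultimately have "(\<lambda>k. measure lebesgue (K (q k) + (\<lambda>x. l *\<^sub>R x) ` E (q k)))
        \<longlonglongrightarrow> measure lebesgue (K' + (\<lambda>x. l *\<^sub>R x) ` E')"
      using body body' unfolding convex_body_def
      by (intro hausdorff_tendsto_measure) (blast intro: compact_imp_closed)+
    moreover have "measure lebesgue (K (q k) + (\<lambda>x. l *\<^sub>R x) ` E (q k)) =
        (\<Sum>i\<le>?n. real (?n choose i) * W (q k) i * l ^ i)" for k
      using W that by (simp add: relative_quermassintegrals_def)
    ultimately show ?thesis by simp
  qed
  have "convergent (\<lambda>k. W (q k) i)" if "i \<le> ?n" for i
  proof -
    have "convergent (\<lambda>k. real (?n choose i) * W (q k) i)"
      using vol by (intro convergent_coefficients[OF _ that, of "\<lambda>k i. real (?n choose i) * W (q k) i"])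
        (auto simp: convergent_def intro!: less_imp_le)
    then show ?thesis
      using that by (subst (asm) convergent_mult_const_iff) auto
  qed
  then obtain W' where W': "\<And>i. i \<le> ?n \<Longrightarrow> (\<lambda>k. W (q k) i) \<longlonglongrightarrow> W' i"
    unfolding convergent_def by metis
  \<comment> \<open>The same sums converge to the volume for the limit bodies and to the polynomial
    with coefficients from \<open>W'\<close>; limits are unique.\<close>
  have "relative_quermassintegrals K' E' W'"
    unfolding relative_quermassintegrals_def
  proof (intro allI impI)
    fix l :: real assume "l \<ge> 0"
    have "(\<lambda>k. \<Sum>i\<le>?n. real (?n choose i) * W (q k) i * l ^ i)
        \<longlonglongrightarrow> (\<Sum>i\<le>?n. real (?n choose i) * W' i * l ^ i)"
      by (intro tendsto_intros W') auto
    then show "measure lebesgue (K' + (\<lambda>x. l *\<^sub>R x) ` E') = (\<Sum>i\<le>?n. real (?n choose i) * W' i * l ^ i)"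
      by (rule LIMSEQ_unique[OF vol[OF \<open>l \<ge> 0\<close>]])
  qed
  moreover have "(\<Sum>i\<le>?n. of_real (real (?n choose i) * W' i) * z ^ i) = 0"
  proof -
    have "strict_mono q"
      using r s by (simp add: q_def strict_mono_o)
    then have "(\<lambda>k. \<zeta> (q k)) \<longlonglongrightarrow> z"
      using LIMSEQ_subseq_LIMSEQ[OF \<open>\<zeta> \<longlonglongrightarrow> z\<close>] by (simp add: o_def)
    \<comment> \<open>Coefficients and roots converge together; by \<open>root\<close> every term of
      this sequence is 0.\<close>
    then have "(\<lambda>k. \<Sum>i\<le>?n. of_real (real (?n choose i) * W (q k) i) * \<zeta> (q k) ^ i)
        \<longlonglongrightarrow> (\<Sum>i\<le>?n. of_real (real (?n choose i) * W' i) * z ^ i)"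
      by (intro tendsto_intros W') auto
    then show ?thesis
      using root by (simp add: LIMSEQ_const_iff)
  qed
  moreover have "aff_dim (K' + E') = int ?n"
  proof -
    note lim = hausdorff_tendsto_plus[OF limK limE]
    have cl: "closed (K' + E')"
      using convex_body_plus[OF KE'] by (simp add: convex_body_def compact_imp_closed)
    have "0 \<in> K' + E'"
      using zero by (rule hausdorff_tendsto_mem[OF lim cl])
    then have "aff_dim (K' + E') = int (dim (K' + E'))"
      by (intro aff_dim_zero hull_inc)
    moreover have "axis i 1 \<in> K' + E'" for i
      using ax by (rule hausdorff_tendsto_mem[OF lim cl])
    then have "Basis \<subseteq> K' + E'"
      by (auto simp: Basis_vec_def)
    then have "span (K' + E') = UNIV"
      using span_mono[of Basis "K' + E'"] by auto
    then have "dim (K' + E') = ?n"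
      using dim_eq_full[of "K' + E'"] by simp
    ultimately show ?thesis by simp
  qed
  moreover have "Im z \<ge> 0"
    using tendsto_Im[OF \<open>\<zeta> \<longlonglongrightarrow> z\<close>] by (rule LIMSEQ_le_const) (use roots in \<open>auto simp: mem_steiner_roots_iff\<close>)
  ultimately show "z \<in> steiner_roots TYPE('n)"
    using KE' by (auto simp: mem_steiner_roots_iff)
qed

end
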